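(* Let $\mathfrak{b}:\mathbb{N}^d\to\mathbb{C}$ be a multi-indexed sequence of complex numbers, and fix some matrix $\mathbf{A}=(a_{ij})\in\mathbf{Mat}_{m\times d}(\mathbb{N})$. Define a new multi-indexed sequence $\mathfrak{c}:\mathbb{N}^m\to\mathbb{C}$ by setting, for $(k_1,\dots,k_m)\in\mathbb{N}^m$, $$\mathfrak{c}_{(k_1,\dots,k_m)}=\sum_{\substack{(j_1,\dots,j_d)\in\mathbb{N}^d\\ (k_1,\dots,k_m)^T=\mathbf{A}(j_1,\dots,j_d)^T}}\mathfrak{b}_{(j_1,\dots,j_d)}.$$ Then the multivariate generating function for the sequence $\mathfrak{c}$ is given by $$G_{\mathfrak{c}}(z_1,\dots,z_m)=G_{\mathfrak{b}}\Bigl(\prod_{i=1}^m z_i^{a_{i1}},\ \dots,\ \prod_{i=1}^m z_i^{a_{id}}\Bigr).$$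
   Context: $\mathbb{N}=\mathbb{Z}_{\ge 0}$, and $\mathbf{Mat}_{m\times d}(\mathbb{N})$ is the set of $m\times d$ matrices with entries in $\mathbb{N}$. The multivariate generating function for a multi-indexed sequence $\mathfrak{b}:\mathbb{N}^d\to\mathbb{C}$ is $G_{\mathfrak{b}}(t_1,\dots,t_d)=\sum_{(j_1,\dots,j_d)\in\mathbb{N}^d}\mathfrak{b}_{(j_1,\dots,j_d)}t_1^{j_1}\cdots t_d^{j_d}$; analogously, $G_{\mathfrak{c}}(z_1,\dots,z_m)=\sum_{(k_1,\dots,k_m)\in\mathbb{N}^m}\mathfrak{c}_{(k_1,\dots,k_m)}z_1^{k_1}\cdots z_m^{k_m}$. *)

theory Defs
  imports "HOL-Analysis.Analysis"
begin

section \<open>Multivariate formal power series\<close>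

text \<open>
  A formal power series over \<open>'a\<close> in variables indexed by the finite type \<open>'n\<close> is the family of
  its coefficients, indexed by exponent vectors in \<open>nat ^ 'n\<close>. No convergence of the series is
  involved.
\<close>

typedef (overloaded) ('a, 'n) mps = "UNIV :: (nat ^ ('n::finite) \<Rightarrow> 'a) set"
  morphisms mps_coeff Abs_mps
  by simp

setup_lifting type_definition_mps

lemma mps_eqI: "(\<And>k. mps_coeff F k = mps_coeff G k) \<Longrightarrow> F = G"
  by (simp add: mps_coeff_inject[symmetric] ext)

lemma mps_coeff_Abs [simp]: "mps_coeff (Abs_mps b) = b"
  by (simp add: Abs_mps_inverse)

definition antidiag :: "nat ^ 'n \<Rightarrow> ((nat ^ 'n) \<times> (nat ^ 'n)) set"
  where "antidiag k = {(i, j). i + j = k}"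

lemma finite_vec_le: "finite {i :: nat ^ 'n::finite. \<forall>l. i $ l \<le> k $ l}"
proof -
  have "finite ((\<lambda>i. ($) i) -` (Pi\<^sub>E UNIV (\<lambda>l. {..k $ l})))"
    by (rule finite_vimageI) (auto intro!: finite_PiE injI simp: vec_eq_iff)
  moreover have "(\<lambda>i. ($) i) -` (Pi\<^sub>E UNIV (\<lambda>l. {..k $ l})) = {i. \<forall>l. i $ l \<le> k $ l}"
    by (auto simp: PiE_def Pi_def)
  ultimately show ?thesis by simp
qed

lemma finite_antidiag [simp]: "finite (antidiag (k :: nat ^ 'n::finite))"
proof (rule finite_subset)
  let ?B = "{i :: nat ^ 'n. \<forall>l. i $ l \<le> k $ l}"
  show "antidiag k \<subseteq> ?B \<times> ?B" by (auto simp: antidiag_def)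
  show "finite (?B \<times> ?B)" by (intro finite_cartesian_product finite_vec_le)
qed

lemma mem_antidiag [simp]: "(i, j) \<in> antidiag k \<longleftrightarrow> i + j = k"
  by (simp add: antidiag_def)

instantiation mps :: (comm_ring_1, finite) comm_ring_1
begin

lift_definition zero_mps :: "('a, 'b) mps" is "\<lambda>_. 0" .

lift_definition one_mps :: "('a, 'b) mps" is "\<lambda>k. if k = 0 then 1 else 0" .

lift_definition plus_mps :: "('a, 'b) mps \<Rightarrow> ('a, 'b) mps \<Rightarrow> ('a, 'b) mps"
  is "\<lambda>f g k. f k + g k" .

lift_definition minus_mps :: "('a, 'b) mps \<Rightarrow> ('a, 'b) mps \<Rightarrow> ('a, 'b) mps"
  is "\<lambda>f g k. f k - g k" .

lift_definition uminus_mps :: "('a, 'b) mps \<Rightarrow> ('a, 'b) mps"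
  is "\<lambda>f k. - f k" .

lift_definition times_mps :: "('a, 'b) mps \<Rightarrow> ('a, 'b) mps \<Rightarrow> ('a, 'b) mps"
  is "\<lambda>f g k. \<Sum>(i, j)\<in>antidiag k. f i * g j" .

instance
proof
  fix F G H :: "('a, 'b) mps"
  show "F * G * H = F * (G * H)"
  proof (transfer, rule ext)
    fix f g h :: "nat ^ 'b \<Rightarrow> 'a" and k
    have "(\<Sum>(u, l)\<in>antidiag k. (\<Sum>(i, j)\<in>antidiag u. f i * g j) * h l)
      = (\<Sum>(p, q)\<in>(SIGMA p:antidiag k. antidiag (fst p)). f (fst q) * g (snd q) * h (snd p))"
      by (subst sum.Sigma[symmetric]) (auto simp: sum_distrib_right case_prod_unfold)
    also have "\<dots> = (\<Sum>(p, q)\<in>(SIGMA p:antidiag k. antidiag (snd p)).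
        f (fst p) * (g (fst q) * h (snd q)))"
      by (rule sum.reindex_bij_witness
          [where i = "\<lambda>(p, q). ((fst p + fst q, snd q), (fst p, fst q))"
             and j = "\<lambda>(p, q). ((fst q, snd q + snd p), (snd q, snd p))"])
         (auto simp: add.assoc mult.assoc)
    also have "\<dots> = (\<Sum>(i, u)\<in>antidiag k. f i * (\<Sum>(j, l)\<in>antidiag u. g j * h l))"
      by (subst sum.Sigma[symmetric]) (auto simp: sum_distrib_left case_prod_unfold)
    finally show "(\<Sum>(u, l)\<in>antidiag k. (\<Sum>(i, j)\<in>antidiag u. f i * g j) * h l)
      = (\<Sum>(i, u)\<in>antidiag k. f i * (\<Sum>(j, l)\<in>antidiag u. g j * h l))" .
  qed
  show "F * G = G * F"
  proof (transfer, rule ext)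
    fix f g :: "nat ^ 'b \<Rightarrow> 'a" and k
    show "(\<Sum>(i, j)\<in>antidiag k. f i * g j) = (\<Sum>(i, j)\<in>antidiag k. g i * f j)"
      by (rule sum.reindex_bij_witness[where i = prod.swap and j = prod.swap])
         (auto simp: add.commute mult.commute)
  qed
  show "1 * F = F"
  proof (transfer, rule ext)
    fix f :: "nat ^ 'b \<Rightarrow> 'a" and k
    have "(\<Sum>(i, j)\<in>antidiag k. (if i = 0 then 1 else 0) * f j)
      = (\<Sum>p\<in>antidiag k. if p = (0, k) then f k else 0)"
      by (rule sum.cong) (auto split: if_splits)
    then show "(\<Sum>(i, j)\<in>antidiag k. (if i = 0 then 1 else 0) * f j) = f k"
      by simp
  qed
  show "(F + G) * H = F * H + G * H"
    by (transfer, rule ext) (simp add: distrib_right sum.distrib case_prod_unfold)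
  show "(0 :: ('a, 'b) mps) \<noteq> 1"
    by transfer (metis zero_neq_one)
qed (transfer; simp add: fun_eq_iff algebra_simps)+

end

definition mps_var :: "'n::finite \<Rightarrow> ('a::comm_ring_1, 'n) mps"
  where "mps_var i = Abs_mps (\<lambda>k. if k = axis i 1 then 1 else 0)"

text \<open>
  Substituting the series \<open>f l\<close> for the \<open>l\<close>-th variable of \<open>F\<close> gives
  \<open>\<Sum>j. mps_coeff F j * (\<Prod>l. f l ^ (j $ l))\<close>, where the infinite sum is taken coefficientwise and
  each coefficient is an unconditionally convergent sum of scalars. The predicate \<open>mps_substable\<close>
  states that all these sums exist; otherwise the affected coefficients of \<open>mps_subst F f\<close> have the
  default value 0 of \<^const>\<open>infsum\<close>.
  If only finitely many terms are nonzero in each coefficient, as is the case when all the \<open>f l\<close>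
  have vanishing constant term, this is the usual substitution of formal power series.
\<close>

definition mps_substable ::
    "('a::{comm_ring_1, t2_space}, 'd::finite) mps \<Rightarrow> ('d \<Rightarrow> ('a, 'm::finite) mps) \<Rightarrow> bool"
  where "mps_substable F f \<longleftrightarrow>
    (\<forall>k. (\<lambda>j. mps_coeff F j * mps_coeff (\<Prod>l\<in>UNIV. f l ^ (j $ l)) k) summable_on UNIV)"

definition mps_subst ::
    "('a::{comm_ring_1, t2_space}, 'd::finite) mps \<Rightarrow> ('d \<Rightarrow> ('a, 'm::finite) mps) \<Rightarrow> ('a, 'm) mps"
  where "mps_subst F f = Abs_mps (\<lambda>k.
    \<Sum>\<^sub>\<infinity>j. mps_coeff F j * mps_coeff (\<Prod>l\<in>UNIV. f l ^ (j $ l)) k)"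

definition mgf :: "(nat ^ 'd \<Rightarrow> 'a) \<Rightarrow> ('a::comm_ring_1, 'd::finite) mps"
  where "mgf b = Abs_mps b"

text \<open>
  The next facts justify reading \<^term>\<open>mgf b\<close> as the sum of the terms
  \<open>b j * (\<Prod>l. mps_var l ^ (j $ l))\<close>: substituting the variables themselves is always possible and
  returns the series.
\<close>

lemma mps_monom_mult:
  "Abs_mps (\<lambda>k. if k = u then 1 else 0) * Abs_mps (\<lambda>k. if k = v then 1 else 0)
    = (Abs_mps (\<lambda>k. if k = u + v then 1 else 0) :: ('a::comm_ring_1, 'n::finite) mps)"
proof (rule mps_eqI)
  fix k :: "nat ^ 'n"
  have "(\<Sum>(i, j)\<in>antidiag k. (if i = u then 1 else 0) * (if j = v then 1 else 0 :: 'a))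
    = (\<Sum>p\<in>antidiag k. if p = (u, v) then 1 else 0)"
    by (rule sum.cong) (auto split: if_splits)
  then show "mps_coeff (Abs_mps (\<lambda>k. if k = u then 1 else 0)
      * Abs_mps (\<lambda>k. if k = v then 1 else 0)) k
    = mps_coeff (Abs_mps (\<lambda>k. if k = u + v then 1 else 0 :: 'a)) k"
    by (auto simp: times_mps.rep_eq)
qed

lemma mps_var_power:
  "(mps_var i :: ('a::comm_ring_1, 'n::finite) mps) ^ n
    = Abs_mps (\<lambda>k. if k = axis i n then 1 else 0)"
proof (induction n)
  case 0
  have "(0 :: nat ^ 'n) = axis i 0" by (simp add: vec_eq_iff axis_def)
  then show ?case by (simp only: one_mps_def power_0)
next
  case (Suc n)
  have "axis i 1 + axis i n = (axis i (Suc n) :: nat ^ 'n)" by (simp add: vec_eq_iff axis_def)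
  then show ?case using Suc by (simp add: mps_monom_mult mps_var_def)
qed

lemma mps_monom_eq_prod_var:
  "(\<Prod>l\<in>UNIV. (mps_var l :: ('a::comm_ring_1, 'n::finite) mps) ^ (j $ l))
    = Abs_mps (\<lambda>k. if k = j then 1 else 0)"
proof -
  have "(\<Prod>l\<in>L. (mps_var l :: ('a, 'n) mps) ^ (j $ l))
      = Abs_mps (\<lambda>k. if k = (\<Sum>l\<in>L. axis l (j $ l)) then 1 else 0)" if "finite L" for L
    using that by induction (simp_all add: one_mps_def mps_var_power mps_monom_mult)
  moreover have "(\<Sum>l\<in>UNIV. axis l (j $ l)) = j"
    by (simp add: vec_eq_iff axis_def)
  ultimately show ?thesis by simp
qed

lemma mps_subst_var_has_sum:
  fixes F :: "('a::{comm_ring_1, t2_space}, 'n::finite) mps"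
  shows "((\<lambda>j. mps_coeff F j * mps_coeff (\<Prod>l\<in>UNIV. mps_var l ^ (j $ l)) k)
    has_sum mps_coeff F k) UNIV"
proof -
  have "((\<lambda>j. mps_coeff F j * mps_coeff (\<Prod>l\<in>UNIV. mps_var l ^ (j $ l)) k)
      has_sum mps_coeff F k) UNIV
    \<longleftrightarrow> (mps_coeff F has_sum mps_coeff F k) {k}"
    by (rule has_sum_cong_neutral) (auto simp: mps_monom_eq_prod_var)
  moreover have "(mps_coeff F has_sum mps_coeff F k) {k}"
    using has_sum_finite[of "{k}" "mps_coeff F"] by simp
  ultimately show ?thesis by blast
qed

lemma mps_substable_var: "mps_substable F mps_var"
  unfolding mps_substable_def using mps_subst_var_has_sum summable_on_def by blast

lemma mps_subst_var: "mps_subst F mps_var = F"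
  by (rule mps_eqI) (simp add: mps_subst_def infsumI[OF mps_subst_var_has_sum])

end

theory Submission
  imports Defs
begin

text \<open>
  Substituting \<open>\<Prod>i. z i ^ (A $ i $ l)\<close> for the \<open>l\<close>-th variable turns the monomial with exponent
  vector \<open>j\<close> into the monomial with exponent vector \<open>A *v j\<close> (\<open>mps_monom_power_matrix\<close>). Thus the
  terms of the substituted series that contribute to the coefficient at \<open>k\<close> are exactly those with
  \<open>A *v j = k\<close>, each contributing \<open>b j\<close>. The sum over all \<open>j\<close> that defines this coefficient
  therefore agrees, up to zero terms, with the sum that defines \<open>c k\<close>, fibre by fibre of
  \<open>j \<mapsto> A *v j\<close>; in particular one exists if and only if the other does.
\<close>

lemma mps_monom_power_matrix:
  fixes A :: "nat ^ 'd::finite ^ 'm::finite"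
  shows "(\<Prod>l\<in>UNIV. (\<Prod>i\<in>UNIV. (mps_var i :: ('a::comm_ring_1, 'm) mps) ^ (A $ i $ l)) ^ (j $ l))
    = Abs_mps (\<lambda>k. if k = A *v j then 1 else 0)"
proof -
  have "(\<Prod>l\<in>UNIV. (\<Prod>i\<in>UNIV. (mps_var i :: ('a, 'm) mps) ^ (A $ i $ l)) ^ (j $ l))
      = (\<Prod>l\<in>UNIV. \<Prod>i\<in>UNIV. mps_var i ^ (A $ i $ l * j $ l))"
    by (simp add: prod_power_distrib power_mult)
  also have "\<dots> = (\<Prod>i\<in>UNIV. \<Prod>l\<in>UNIV. mps_var i ^ (A $ i $ l * j $ l))"
    by (rule prod.swap)
  also have "\<dots> = (\<Prod>i\<in>UNIV. mps_var i ^ ((A *v j) $ i))"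
    by (simp add: power_sum matrix_vector_mult_def)
  finally show ?thesis
    by (simp only: mps_monom_eq_prod_var)
qed

theorem theorem1:
  fixes b :: "nat ^ 'd::finite \<Rightarrow> complex"
    and A :: "nat ^ 'd ^ 'm::finite"
    and c :: "nat ^ 'm \<Rightarrow> complex"
  assumes c: "\<And>k. (b has_sum c k) {j. k = A *v j}"
  shows "mps_substable (mgf b) (\<lambda>l. \<Prod>i\<in>UNIV. (mps_var i :: (complex, 'm) mps) ^ (A $ i $ l)) \<and>
    mgf c = mps_subst (mgf b) (\<lambda>l. \<Prod>i\<in>UNIV. mps_var i ^ (A $ i $ l))"
proof -
  have coeff_has_sum: "((\<lambda>j. mps_coeff (mgf b) j *
      mps_coeff (\<Prod>l\<in>UNIV. (\<Prod>i\<in>UNIV. mps_var i ^ (A $ i $ l)) ^ (j $ l)) k)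
      has_sum c k) UNIV" (is "(?t has_sum _) _") for k
  proof -
    have "(?t has_sum c k) UNIV \<longleftrightarrow> (b has_sum c k) {j. k = A *v j}"
      by (rule has_sum_cong_neutral) (auto simp: mps_monom_power_matrix mgf_def)
    with c show ?thesis by blast
  qed
  show ?thesis
  proof
    show "mps_substable (mgf b) (\<lambda>l. \<Prod>i\<in>UNIV. (mps_var i :: (complex, 'm) mps) ^ (A $ i $ l))"
      unfolding mps_substable_def using coeff_has_sum summable_on_def by blast
    show "mgf c = mps_subst (mgf b) (\<lambda>l. \<Prod>i\<in>UNIV. mps_var i ^ (A $ i $ l))"
      by (rule mps_eqI) (simp add: mps_subst_def infsumI[OF coeff_has_sum] mgf_def[of c])
  qed
qed

end
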